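(* If $S\subset\mathbb{R}^n$ is a finite exact point set, then $\mathrm{conv}(S)$ has at most $2^d$ facets and at most $2^d$ vertices, where $d=\dim\mathrm{conv}(S)$. Both bounds are sharp: for every $d\ge1$ there is a finite exact set whose convex hull is $d$-dimensional with exactly $2^d$ facets, and there is a finite exact set whose convex hull is $d$-dimensional with exactly $2^d$ vertices.
   Context: A polynomial in $\mathbb{R}[\mathbf{x}]=\mathbb{R}[x_1,\ldots,x_n]$ is linear if it has degree at most $1$. For an ideal $I\subseteq\mathbb{R}[\mathbf{x}]$, $f$ is $1$-sos mod $I$ if there are linear polynomials $h_1,\ldots,h_t$ with $f-\sum_j h_j^2\in I$, and $\mathrm{TH}_1(I):=\{\mathbf{x}\in\mathbb{R}^n : f(\mathbf{x})\ge0\text{ for every linear } f\text{ that is }1\text{-sos mod } I\}$. A finite set $S\subset\mathbb{R}^n$ is exact if its vanishing ideal $\mathcal{I}(S)$ (all polynomials vanishing on $S$) is $\mathrm{TH}_1$-exact, i.e., $\mathrm{TH}_1(\mathcal{I}(S))=\mathrm{conv}(S)$. *)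

theory Defs
  imports "HOL-Analysis.Analysis" "HOL-Library.Poly_Mapping"
begin

text \<open>
  The polynomial ring \<open>\<real>[x\<^sub>i : i \<in> 'n]\<close> as the monoid algebra of finitely supported exponent
  vectors: addition, subtraction and the (convolution) product are the ones of
  \<open>Poly_Mapping\<close>, for which this type is an instance of \<open>comm_ring_1\<close>.
\<close>

type_synonym 'n rpoly = "('n \<Rightarrow>\<^sub>0 nat) \<Rightarrow>\<^sub>0 real"

definition eval_rpoly :: "'n::finite rpoly \<Rightarrow> real ^ 'n \<Rightarrow> real" where
  "eval_rpoly p x =
     (\<Sum>m\<in>Poly_Mapping.keys p. Poly_Mapping.lookup p m * (\<Prod>i\<in>UNIV. (x $ i) ^ Poly_Mapping.lookup m i))"

text \<open>Total degree, with value \<open>0\<close> on the zero polynomial.\<close>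

definition total_deg :: "'n::finite rpoly \<Rightarrow> nat" where
  "total_deg p = Max (insert 0 ((\<lambda>m. \<Sum>i\<in>UNIV. Poly_Mapping.lookup m i) ` Poly_Mapping.keys p))"

definition linear_rpoly :: "'n::finite rpoly \<Rightarrow> bool" where
  "linear_rpoly p \<longleftrightarrow> total_deg p \<le> 1"

definition one_sos_mod :: "'n::finite rpoly set \<Rightarrow> 'n rpoly \<Rightarrow> bool" where
  "one_sos_mod I f \<longleftrightarrow>
     (\<exists>hs :: 'n rpoly list. (\<forall>h\<in>set hs. linear_rpoly h) \<and> f - (\<Sum>h\<leftarrow>hs. h ^ 2) \<in> I)"

definition TH1 :: "'n::finite rpoly set \<Rightarrow> (real ^ 'n) set" where
  "TH1 I = {x. \<forall>f. linear_rpoly f \<and> one_sos_mod I f \<longrightarrow> 0 \<le> eval_rpoly f x}"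

definition vanishing_ideal :: "(real ^ 'n::finite) set \<Rightarrow> 'n rpoly set" where
  "vanishing_ideal S = {p. \<forall>x\<in>S. eval_rpoly p x = 0}"

definition exact_set :: "(real ^ 'n::finite) set \<Rightarrow> bool" where
  "exact_set S \<longleftrightarrow> finite S \<and> TH1 (vanishing_ideal S) = convex hull S"

definition facets :: "'a::euclidean_space set \<Rightarrow> 'a set set" where
  "facets P = {F. F facet_of P}"

definition vertices :: "'a::euclidean_space set \<Rightarrow> 'a set" where
  "vertices P = {v. v extreme_point_of P}"

end

theory Submission
  imports Defs
begin

text \<open>
  On an exact set every facet-defining affine function takes at most two values: a third value
  would produce a point of the theta body outside the hull, as the barycentre of a suitable signed
  measure. A point of \<open>S\<close> is then determined by the subset it annihilates of \<open>d\<close> facet equations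
  with independent normals, and a facet by its intersection with an affine basis (\<open>d\<close> points) of
  one fixed facet. The cube attains the bound for vertices and the cross-polytope the one for facets.
\<close>

subsection \<open>Evaluation of polynomials and the first theta body\<close>

text \<open>A signed measure on \<open>S\<close> of positive total mass that is nonnegative on
  squares of affine functions has its barycentre in the first theta body; this is how points outside
  the hull arise. The obstacle is to keep that nonnegativity although one mass is negative. The
  zeros of a facet equation g span a hyperplane of the affine hull, so an affine function vanishing
  on these zeros is a multiple of g there. On such multiples squares and g itself scale differently:
  if r = g p / g q < 1, a mass at q outweighs the mass -1 at p on squares once it exceeds r^2, but
  on g only once it exceeds r. Two distinct positive values leave a gap between the two thresholds.
  All other directions are paid for by mass on the zeros, which g does not see.\<close>

abbreviation aff :: "real \<times> 'a::real_inner \<Rightarrow> 'a \<Rightarrow> real" where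
  "aff h x \<equiv> fst h + snd h \<bullet> x"

definition monom_eval :: "('n::finite \<Rightarrow>\<^sub>0 nat) \<Rightarrow> real ^ 'n \<Rightarrow> real" where
  "monom_eval m x = (\<Prod>i\<in>UNIV. (x $ i) ^ Poly_Mapping.lookup m i)"

lemma monom_eval_0: "monom_eval 0 x = 1"
  by (simp add: monom_eval_def)

lemma monom_eval_add: "monom_eval (m + k) x = monom_eval m x * monom_eval k x"
  by (simp add: monom_eval_def lookup_add power_add prod.distrib)

lemma monom_eval_unit: "monom_eval (Poly_Mapping.single i 1) x = x $ i"
proof -
  have "monom_eval (Poly_Mapping.single i 1) x = (\<Prod>j\<in>UNIV. if j = i then x $ i else 1)"
    unfolding monom_eval_def by (rule prod.cong) (auto simp: lookup_single when_def)
  then show ?thesis by simp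
qed

text \<open>Lets several polynomials be evaluated over one common index set, although coefficients
  may cancel and keys disappear.\<close>

lemma eval_rpoly_superset:
  assumes "finite A" "Poly_Mapping.keys p \<subseteq> A"
  shows "eval_rpoly p x = (\<Sum>m\<in>A. Poly_Mapping.lookup p m * monom_eval m x)"
  unfolding eval_rpoly_def monom_eval_def[symmetric]
  by (rule sum.mono_neutral_left) (use assms in \<open>auto simp: in_keys_iff\<close>)

lemma eval_rpoly_add: "eval_rpoly (p + q) x = eval_rpoly p x + eval_rpoly q x"
proof -
  let ?A = "Poly_Mapping.keys p \<union> Poly_Mapping.keys q"
  have "eval_rpoly r x = (\<Sum>m\<in>?A. Poly_Mapping.lookup r m * monom_eval m x)"
    if "Poly_Mapping.keys r \<subseteq> ?A" for r
    using that by (intro eval_rpoly_superset) auto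
  then show ?thesis
    using keys_add[of p q] by (simp add: lookup_add distrib_right sum.distrib)
qed

lemma eval_rpoly_0: "eval_rpoly 0 x = 0"
  by (simp add: eval_rpoly_def)

lemma eval_rpoly_diff: "eval_rpoly (p - q) x = eval_rpoly p x - eval_rpoly q x"
  using eval_rpoly_add[of "p - q" q x] by simp

lemma eval_rpoly_sum: "eval_rpoly (sum f A) x = (\<Sum>i\<in>A. eval_rpoly (f i) x)"
  by (induction A rule: infinite_finite_induct) (auto simp: eval_rpoly_0 eval_rpoly_add)

lemma eval_rpoly_single: "eval_rpoly (Poly_Mapping.single m c) x = c * monom_eval m x"
  by (subst eval_rpoly_superset[where A = "{m}"]) auto

lemma poly_mapping_sum_single:
  fixes p :: "'a \<Rightarrow>\<^sub>0 'b::comm_monoid_add"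
  shows "p = (\<Sum>m\<in>Poly_Mapping.keys p. Poly_Mapping.single m (Poly_Mapping.lookup p m))"
  by (rule poly_mapping_eqI) (auto simp: lookup_sum lookup_single when_def in_keys_iff)

text \<open>Bilinearity reduces this to products of monomials, where convolution is just addition of
  exponents.\<close>

lemma eval_rpoly_mult: "eval_rpoly (p * q) x = eval_rpoly p x * eval_rpoly q x"
proof -
  let ?s = "\<lambda>p m. Poly_Mapping.single m (Poly_Mapping.lookup p m)"
  let ?p = "\<Sum>m\<in>Poly_Mapping.keys p. ?s p m" and ?q = "\<Sum>k\<in>Poly_Mapping.keys q. ?s q k"
  have "eval_rpoly (?p * ?q) x = eval_rpoly ?p x * eval_rpoly ?q x"
    by (simp add: sum_product eval_rpoly_sum mult_single eval_rpoly_single monom_eval_add mult_ac)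
  then show ?thesis
    by (simp only: poly_mapping_sum_single[symmetric])
qed

lemma eval_rpoly_sum_squares:
  "eval_rpoly (\<Sum>h\<leftarrow>hs. (f h)\<^sup>2) x = (\<Sum>h\<leftarrow>hs. (eval_rpoly (f h) x)\<^sup>2)"
  by (induction hs) (auto simp: eval_rpoly_0 eval_rpoly_add eval_rpoly_mult power2_eq_square)

section \<open>Linear polynomials as affine functions\<close>

lemma degree_le_1_exponent_cases:
  fixes m :: "'n::finite \<Rightarrow>\<^sub>0 nat"
  assumes "(\<Sum>i\<in>UNIV. Poly_Mapping.lookup m i) \<le> 1"
  shows "m = 0 \<or> (\<exists>i. m = Poly_Mapping.single i 1)"
proof (cases "m = 0")
  case False
  then obtain i where i: "Poly_Mapping.lookup m i \<noteq> 0"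
    by (metis lookup_zero poly_mapping_eqI)
  have "(\<Sum>j\<in>UNIV. Poly_Mapping.lookup m j) =
      Poly_Mapping.lookup m i + (\<Sum>j\<in>UNIV - {i}. Poly_Mapping.lookup m j)"
    by (rule sum.remove) auto
  with i assms have "Poly_Mapping.lookup m i = 1"
      and rest: "(\<Sum>j\<in>UNIV - {i}. Poly_Mapping.lookup m j) = 0"
    by linarith+
  then have "m = Poly_Mapping.single i 1"
    by (intro poly_mapping_eqI) (auto simp: lookup_single when_def)
  then show ?thesis by blast
qed simp

lemma linear_rpoly_eval:
  fixes p :: "'n::finite rpoly"
  assumes "linear_rpoly p"
  obtains h where "\<And>x. eval_rpoly p x = aff h x"
proof -
  let ?u = "\<lambda>i::'n. Poly_Mapping.single i (1::nat)"
  let ?A = "insert 0 (range ?u)"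
  have "Poly_Mapping.keys p \<subseteq> ?A"
  proof
    fix m assume m: "m \<in> Poly_Mapping.keys p"
    then have "(\<Sum>i\<in>UNIV. Poly_Mapping.lookup m i) \<le> total_deg p"
      unfolding total_deg_def by (intro Max_ge) auto
    with assms show "m \<in> ?A"
      using degree_le_1_exponent_cases[of m] by (auto simp: linear_rpoly_def)
  qed
  then have 1: "eval_rpoly p x = (\<Sum>m\<in>?A. Poly_Mapping.lookup p m * monom_eval m x)" for x
    by (intro eval_rpoly_superset) auto
  have 2: "(\<Sum>m\<in>?A. Poly_Mapping.lookup p m * monom_eval m x)
      = Poly_Mapping.lookup p 0 + (\<Sum>i\<in>UNIV. Poly_Mapping.lookup p (?u i) * x $ i)" for x
  proof -
    have "inj ?u"
    proof (rule injI)
      fix i j assume "?u i = ?u j"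
      then have "Poly_Mapping.keys (?u i) = Poly_Mapping.keys (?u j)" by (rule arg_cong)
      then show "i = j" by simp
    qed
    moreover have "0 \<notin> range ?u"
    proof
      assume "0 \<in> range ?u"
      then obtain i where "?u i = 0" by force
      then have "Poly_Mapping.keys (?u i) = {}" by simp
      then show False by simp
    qed
    ultimately show ?thesis
      by (simp add: monom_eval_0 monom_eval_unit sum.reindex del: One_nat_def)
  qed
  have "eval_rpoly p x
      = aff (Poly_Mapping.lookup p 0, \<chi> i. Poly_Mapping.lookup p (?u i)) x" for x
    unfolding 1 2 by (simp add: inner_vec_def)
  then show thesis by (rule that)
qed

definition rpoly_of_aff :: "real \<times> (real ^ 'n) \<Rightarrow> 'n::finite rpoly" where
  "rpoly_of_aff h = Poly_Mapping.single 0 (fst h)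
     + (\<Sum>i\<in>UNIV. Poly_Mapping.single (Poly_Mapping.single i 1) (snd h $ i))"

lemma eval_rpoly_of_aff: "eval_rpoly (rpoly_of_aff h) x = aff h x"
  by (simp add: rpoly_of_aff_def eval_rpoly_add eval_rpoly_sum eval_rpoly_single monom_eval_0
      monom_eval_unit inner_vec_def del: One_nat_def)

lemma linear_rpoly_of_aff: "linear_rpoly (rpoly_of_aff (h :: real \<times> (real ^ 'n::finite)))"
proof -
  have "(\<Sum>i\<in>UNIV. Poly_Mapping.lookup m i) \<le> 1" if "m \<in> Poly_Mapping.keys (rpoly_of_aff h)" for m
  proof -
    have "m = 0 \<or> (\<exists>i. m = Poly_Mapping.single i 1)"
    proof (rule ccontr)
      assume "\<not> ?thesis"
      then have "Poly_Mapping.lookup (rpoly_of_aff h) m = 0"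
        by (auto simp: rpoly_of_aff_def lookup_add lookup_sum lookup_single when_def
            intro!: sum.neutral)
      with that show False by (simp add: in_keys_iff)
    qed
    then show ?thesis by (auto simp: lookup_single when_def)
  qed
  then show ?thesis
    by (auto simp: linear_rpoly_def total_deg_def)
qed

text \<open>Membership in the vanishing ideal tests only values on \<open>S\<close>, so polynomials
  of degree at most 1 can be traded for affine functions in both directions. The geometric arguments
  use the theta body only through this form.\<close>

lemma in_TH1_vanishing_ideal_iff:
  fixes x :: "real ^ 'n::finite"
  shows "x \<in> TH1 (vanishing_ideal S) \<longleftrightarrow>
     (\<forall>f hs. (\<forall>s\<in>S. aff f s = (\<Sum>h\<leftarrow>hs. (aff h s)\<^sup>2)) \<longrightarrow> 0 \<le> aff f x)"
  (is "?L \<longleftrightarrow> ?R")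
proof
  assume L: ?L
  show ?R
  proof (intro allI impI)
    fix f hs assume eq: "\<forall>s\<in>S. aff f s = (\<Sum>h\<leftarrow>hs. (aff h s)\<^sup>2)"
    have "one_sos_mod (vanishing_ideal S) (rpoly_of_aff f)"
      unfolding one_sos_mod_def
      by (rule exI[of _ "map rpoly_of_aff hs"])
        (use eq in \<open>auto simp: linear_rpoly_of_aff vanishing_ideal_def eval_rpoly_diff
          eval_rpoly_sum_squares eval_rpoly_of_aff o_def\<close>)
    with L have "0 \<le> eval_rpoly (rpoly_of_aff f) x"
      using linear_rpoly_of_aff[of f] unfolding TH1_def by blast
    then show "0 \<le> aff f x" by (simp add: eval_rpoly_of_aff)
  qed
next
  assume R: ?R
  have "0 \<le> eval_rpoly p x" if lin: "linear_rpoly p" and sos: "one_sos_mod (vanishing_ideal S) p" for p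
  proof -
    obtain f where f: "\<And>x. eval_rpoly p x = aff f x"
      using linear_rpoly_eval[OF lin] by blast
    obtain hs where hs: "\<forall>h\<in>set hs. linear_rpoly h" "p - (\<Sum>h\<leftarrow>hs. h ^ 2) \<in> vanishing_ideal S"
      using sos by (auto simp: one_sos_mod_def)
    have "\<forall>h :: 'n rpoly. \<exists>g. linear_rpoly h \<longrightarrow> (\<forall>x. eval_rpoly h x = aff g x)"
      using linear_rpoly_eval by metis
    from choice[OF this] obtain g :: "'n rpoly \<Rightarrow> real \<times> (real ^ 'n)"
      where g: "\<And>h x. linear_rpoly h \<Longrightarrow> eval_rpoly h x = aff (g h) x"
      by blast
    have "(\<Sum>h\<leftarrow>hs. (eval_rpoly h s)\<^sup>2) = (\<Sum>h\<leftarrow>map g hs. (aff h s)\<^sup>2)" for s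
      unfolding map_map by (rule arg_cong[of _ _ sum_list], rule map_cong) (use g hs(1) in auto)
    then have "\<forall>s\<in>S. aff f s = (\<Sum>h\<leftarrow>map g hs. (aff h s)\<^sup>2)"
      using hs(2) by (simp add: vanishing_ideal_def eval_rpoly_diff eval_rpoly_sum_squares f)
    with R have "0 \<le> aff f x" by blast
    with f show ?thesis by simp
  qed
  then show ?L by (auto simp: TH1_def)
qed

lemma convex_hull_subset_TH1: "convex hull S \<subseteq> TH1 (vanishing_ideal S)"
proof
  fix x assume x: "x \<in> convex hull S"
  have "0 \<le> aff f x" if eq: "\<forall>s\<in>S. aff f s = (\<Sum>h\<leftarrow>hs. (aff h s)\<^sup>2)" for f hs
  proof -
    have "S \<subseteq> {y. - fst f \<le> snd f \<bullet> y}"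
    proof
      fix s assume "s \<in> S"
      moreover have "0 \<le> (\<Sum>h\<leftarrow>hs. (aff h s)\<^sup>2)"
        by (rule sum_list_nonneg) auto
      ultimately show "s \<in> {y. - fst f \<le> snd f \<bullet> y}" using eq by force
    qed
    then have "convex hull S \<subseteq> {y. - fst f \<le> snd f \<bullet> y}"
      by (rule hull_minimal) (auto simp: convex_halfspace_ge)
    with x show ?thesis by auto
  qed
  then show "x \<in> TH1 (vanishing_ideal S)" by (auto simp: in_TH1_vanishing_ideal_iff)
qed

subsection \<open>Exact sets are two-level\<close>

lemma aff_affine_combination:
  assumes "sum u G = 1"
  shows "aff h (\<Sum>s\<in>G. u s *\<^sub>R s) = (\<Sum>s\<in>G. u s * aff h s)"
  using assms by (simp add: inner_sum_right distrib_left sum.distrib flip: sum_distrib_right)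

text \<open>The coefficient of \<open>X\<^sup>2\<close> is positive, so enough
  \<open>y\<^sup>2\<close> makes the form positive semidefinite; \<open>?K\<close> comes from
  completing the square. In the application \<open>X\<close>, \<open>y\<close> and
  \<open>t * X + (1 - t) * y\<close> are the values of an affine function at \<open>p\<close>,
  \<open>z\<close> and \<open>q\<close>.\<close>

lemma quadratic_lower_bound:
  fixes \<beta> t :: real
  assumes "1 < \<beta> * t\<^sup>2"
  obtains K where "0 \<le> K" "\<And>X y. 0 \<le> \<beta> * (t * X + (1 - t) * y)\<^sup>2 - X\<^sup>2 + K * y\<^sup>2"
proof -
  let ?A = "\<beta> * t\<^sup>2 - 1" and ?B = "\<beta> * t * (1 - t)" and ?C = "\<beta> * (1 - t)\<^sup>2"
  let ?K = "\<bar>?C\<bar> + ?B\<^sup>2 / ?A"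
  have A: "?A > 0" using assms by simp
  have "0 \<le> \<beta> * (t * X + (1 - t) * y)\<^sup>2 - X\<^sup>2 + ?K * y\<^sup>2" for X y
  proof -
    have "\<beta> * (t * X + (1 - t) * y)\<^sup>2 - X\<^sup>2 + ?K * y\<^sup>2
        = (?A * X\<^sup>2 + 2 * ?B * (X * y) + ?B\<^sup>2 / ?A * y\<^sup>2) + (?C + \<bar>?C\<bar>) * y\<^sup>2"
      by (simp add: power2_eq_square algebra_simps)
    also have "?A * X\<^sup>2 + 2 * ?B * (X * y) + ?B\<^sup>2 / ?A * y\<^sup>2 = (?A * X + ?B * y)\<^sup>2 / ?A"
      using A by (simp add: field_simps power2_eq_square)
    finally show ?thesis using A by simp
  qed
  moreover have "0 \<le> ?K" using A by simp
  ultimately show thesis by (rule that[rotated])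
qed

text \<open>
  If \<open>g\<close> took a third value on \<open>S\<close>, at \<open>q\<close>, then the signed measure with a large mass
  on the zeros \<open>G\<close> of \<open>g\<close>, mass \<open>- 1\<close> at \<open>p\<close> and mass \<open>\<beta>\<close> at \<open>q\<close>, where
  \<open>(g p / g q)\<^sup>2 < \<beta> < g p / g q\<close>, would be nonnegative on squares of affine functions but negative
  on \<open>g\<close>; so its barycentre lies in the first theta body and outside the convex hull.
\<close>
lemma exact_set_values:
  fixes S :: "(real ^ 'n::finite) set"
  assumes ex: "exact_set S" and nonneg: "\<And>s. s \<in> S \<Longrightarrow> 0 \<le> aff g s"
    and hull: "affine hull {s \<in> S. aff g s = 0} = affine hull S \<inter> {x. aff g x = 0}"
    and p: "p \<in> S" "0 < aff g p" and q: "q \<in> S"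
  shows "aff g q \<le> aff g p"
proof (rule ccontr)
  assume "\<not> aff g q \<le> aff g p"
  then have qp: "aff g p < aff g q" by simp
  define G where "G = {s \<in> S. aff g s = 0}"
  define t r where "t = aff g q / aff g p" and "r = aff g p / aff g q"
  \<comment> \<open>The midpoint of the gap between r^2 and r. The lower bound gives 1 < \<beta>
    t^2, as \<open>quadratic_lower_bound\<close> demands; the upper bound makes g negative.\<close>
  define \<beta> where "\<beta> = (r + r\<^sup>2) / 2"
  have finG: "finite G" using ex by (simp add: exact_set_def G_def)
  have r: "0 < r" "r < 1" using p qp by (auto simp: r_def)
  have r2: "r\<^sup>2 < r" using r by (simp add: power2_eq_square)
  have t: "1 < t" using p qp by (simp add: t_def)
  have rt: "r * t = 1" using p qp by (simp add: t_def r_def)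
  have \<beta>: "0 < \<beta>" "\<beta> < r" "r\<^sup>2 < \<beta>" using r r2 by (auto simp: \<beta>_def add_pos_pos)
  have "r\<^sup>2 * t\<^sup>2 < \<beta> * t\<^sup>2"
    by (rule mult_strict_right_mono) (use \<beta> t in auto)
  then have "1 < \<beta> * t\<^sup>2" using rt by (simp flip: power_mult_distrib)
  then obtain K where K: "0 \<le> K"
    "\<And>X y. 0 \<le> \<beta> * (t * X + (1 - t) * y)\<^sup>2 - X\<^sup>2 + K * y\<^sup>2"
    by (rule quadratic_lower_bound) blast
  \<comment> \<open>The intersection of the line through \<open>p\<close> and \<open>q\<close> with
    the hyperplane g = 0. As an affine combination of the zeros of g, it ties the values at
    \<open>p\<close> and \<open>q\<close> to those on \<open>G\<close>.\<close>
  define z where "z = (1 / (1 - t)) *\<^sub>R (q - t *\<^sub>R p)"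
  have z: "z = (1 / (1 - t)) *\<^sub>R q + (- t / (1 - t)) *\<^sub>R p"
    by (simp add: z_def scaleR_diff_right)
  have z_sum: "1 / (1 - t) + (- t / (1 - t)) = 1" using t by (simp add: field_simps)
  have aff_z: "aff h z = (aff h q - t * aff h p) / (1 - t)" for h
  proof -
    have "(1 - t) * (snd h \<bullet> z) = snd h \<bullet> q - t * (snd h \<bullet> p)"
      using t by (simp add: z_def inner_diff_right)
    then show ?thesis using t by (simp add: eq_divide_eq algebra_simps)
  qed
  have "z \<in> affine hull S"
    unfolding z by (rule mem_affine[OF affine_affine_hull]) (use p q z_sum in \<open>auto intro: hull_inc\<close>)
  moreover have "aff g z = 0" unfolding aff_z using p by (simp add: t_def)
  ultimately have "z \<in> affine hull G" using hull by (auto simp: G_def)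
  then obtain u where u: "sum u G = 1" "(\<Sum>s\<in>G. u s *\<^sub>R s) = z"
    using affine_hull_finite[OF finG] by auto
  \<comment> \<open>By Cauchy-Schwarz \<open>C\<close> bounds the square of h at \<open>z\<close> by
    the squares of h on \<open>G\<close>, so mass \<open>K * C\<close> on each zero absorbs the
    error term; the extra 1 in \<open>M\<close> keeps the total mass positive.\<close>
  define C where "C = (\<Sum>s\<in>G. (u s)\<^sup>2)"
  define M where "M = K * C + 1"
  have C: "0 \<le> C" by (simp add: C_def sum_nonneg)
  have M: "1 \<le> M" using K C by (simp add: M_def)
  have cardG: "1 \<le> card G"
    using u(1) finG by (metis One_nat_def Suc_leI card_gt_0_iff sum.empty zero_neq_one)
  have pos: "0 \<le> M * (\<Sum>s\<in>G. (aff h s)\<^sup>2) - (aff h p)\<^sup>2 + \<beta> * (aff h q)\<^sup>2" for h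
  proof -
    let ?Q = "\<Sum>s\<in>G. (aff h s)\<^sup>2"
    have "(aff h z)\<^sup>2 = (\<Sum>s\<in>G. u s * aff h s)\<^sup>2"
      using aff_affine_combination[OF u(1), of h] u(2) by simp
    also have "\<dots> \<le> C * ?Q" unfolding C_def by (rule Cauchy_Schwarz_ineq_sum)
    finally have "K * (aff h z)\<^sup>2 \<le> K * (C * ?Q)" using K(1) by (rule mult_left_mono)
    moreover have "K * (C * ?Q) \<le> M * ?Q"
      unfolding M_def by (simp add: distrib_right sum_nonneg)
    moreover have hq: "aff h q = t * aff h p + (1 - t) * aff h z"
      using t unfolding aff_z by simp
    ultimately show ?thesis using K(2)[of "aff h p" "aff h z"] unfolding hq by linarith
  qed
  \<comment> \<open>\<open>W\<close> is the total mass of the measure and \<open>x\<close> below its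
    barycentre, so \<open>W * aff f x\<close> is the integral of f.\<close>
  define W where "W = M * card G - 1 + \<beta>"
  have "1 * 1 \<le> M * real (card G)" by (rule mult_mono) (use M cardG in auto)
  then have W: "0 < W" using \<beta> by (simp add: W_def)
  define x where "x = (1 / W) *\<^sub>R (M *\<^sub>R (\<Sum>s\<in>G. s) - p + \<beta> *\<^sub>R q)"
  have aff_x: "W * aff f x = M * (\<Sum>s\<in>G. aff f s) - aff f p + \<beta> * aff f q" for f
  proof -
    have "W * aff f x = W * fst f + snd f \<bullet> (M *\<^sub>R (\<Sum>s\<in>G. s) - p + \<beta> *\<^sub>R q)"
      using W by (simp add: x_def distrib_left)
    then show ?thesis
      by (simp add: W_def inner_add_right inner_diff_right inner_sum_right sum.distrib algebra_simps)
  qed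
  have "x \<in> TH1 (vanishing_ideal S)"
    unfolding in_TH1_vanishing_ideal_iff
  proof (intro allI impI)
    fix f hs assume eq: "\<forall>s\<in>S. aff f s = (\<Sum>h\<leftarrow>hs. (aff h s)\<^sup>2)"
    have "(\<Sum>s\<in>G. aff f s) = (\<Sum>s\<in>G. \<Sum>h\<leftarrow>hs. (aff h s)\<^sup>2)"
      by (rule sum.cong) (use eq in \<open>auto simp: G_def\<close>)
    then have "W * aff f x = M * (\<Sum>s\<in>G. \<Sum>h\<leftarrow>hs. (aff h s)\<^sup>2)
        - (\<Sum>h\<leftarrow>hs. (aff h p)\<^sup>2) + \<beta> * (\<Sum>h\<leftarrow>hs. (aff h q)\<^sup>2)"
      unfolding aff_x using eq p q by simp
    also have "\<dots> = (\<Sum>h\<leftarrow>hs. M * (\<Sum>s\<in>G. (aff h s)\<^sup>2) - (aff h p)\<^sup>2 + \<beta> * (aff h q)\<^sup>2)"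
      by (induction hs) (auto simp: sum.distrib algebra_simps)
    also have "0 \<le> \<dots>" by (rule sum_list_nonneg) (use pos in auto)
    finally show "0 \<le> aff f x" using W by (simp add: zero_le_mult_iff)
  qed
  then have "x \<in> convex hull S" using ex by (simp add: exact_set_def)
  moreover have "convex hull S \<subseteq> {y. - fst g \<le> snd g \<bullet> y}"
    by (rule hull_minimal) (use nonneg in \<open>force simp: convex_halfspace_ge\<close>)+
  ultimately have "0 \<le> aff g x" by auto
  \<comment> \<open>The mass \<open>M\<close> sits on zeros of g and drops out; only the masses at
    \<open>p\<close> and \<open>q\<close> remain.\<close>
  moreover have "W * aff g x < 0"
  proof -
    have "\<beta> * aff g q < r * aff g q" by (rule mult_strict_right_mono) (use \<beta> p qp in auto)
    also have "\<dots> = aff g p" using p qp by (simp add: r_def)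
    finally show ?thesis unfolding aff_x by (simp add: G_def)
  qed
  ultimately show False using W by (simp add: mult_less_0_iff)
qed

text \<open>A face of a polytope is the hull of some of the generators, and these must lie on the
  hyperplane. Hence a facet can be recovered from the points of \<open>S\<close> that its equation
  annihilates.\<close>

lemma convex_hull_Int_supporting_hyperplane:
  fixes S :: "'a::euclidean_space set"
  assumes "finite S" "\<And>s. s \<in> S \<Longrightarrow> a \<bullet> s \<le> b"
  shows "convex hull S \<inter> {x. a \<bullet> x = b} = convex hull {s \<in> S. a \<bullet> s = b}"
proof -
  have "convex hull S \<subseteq> {x. a \<bullet> x \<le> b}"
    by (rule hull_minimal) (use assms in \<open>auto simp: convex_halfspace_le\<close>)
  then have "(convex hull S \<inter> {x. a \<bullet> x = b}) face_of convex hull S"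
    by (intro face_of_Int_supporting_hyperplane_le) auto
  then obtain T where T: "T \<subseteq> S" "convex hull S \<inter> {x. a \<bullet> x = b} = convex hull T"
    using face_of_convex_hull_subset[OF finite_imp_compact[OF assms(1)]] by metis
  then have "T \<subseteq> {s \<in> S. a \<bullet> s = b}" using hull_subset[of T convex] by auto
  then have "convex hull T \<subseteq> convex hull {s \<in> S. a \<bullet> s = b}" by (rule hull_mono)
  moreover have "convex hull {s \<in> S. a \<bullet> s = b} \<subseteq> convex hull S \<inter> {x. a \<bullet> x = b}"
    by (rule hull_minimal) (auto intro: hull_inc convex_Int convex_hyperplane)
  ultimately show ?thesis using T by auto
qed

text \<open>Quantifies over inequalities, since a facet of a hull that is not full-dimensional has
  many of them, and over all points of \<open>S\<close>, so that \<open>card S\<close> itself can be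
  bounded.\<close>

definition two_level :: "'a::euclidean_space set \<Rightarrow> bool" where
  "two_level S \<longleftrightarrow> (\<forall>a b. (\<forall>s\<in>S. a \<bullet> s \<le> b) \<longrightarrow>
     (convex hull S \<inter> {x. a \<bullet> x = b}) facet_of convex hull S \<longrightarrow>
     (\<forall>p\<in>S. \<forall>q\<in>S. a \<bullet> p < b \<longrightarrow> a \<bullet> q < b \<longrightarrow> a \<bullet> p = a \<bullet> q))"

text \<open>\<open>exact_set_values\<close> bounds each positive slack by every other one, and
  symmetry gives equality. Its spanning hypothesis is a dimension count: \<open>p\<close> lies off
  the hyperplane, so \<open>?H\<close> is a proper affine subspace of the affine hull of
  \<open>S\<close> and cannot exceed the span of the points on the facet.\<close>

lemma exact_set_two_level:
  assumes ex: "exact_set S"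
  shows "two_level S"
  unfolding two_level_def
proof (intro allI impI ballI)
  fix a b p q
  assume le: "\<forall>s\<in>S. a \<bullet> s \<le> b"
    and facet: "(convex hull S \<inter> {x. a \<bullet> x = b}) facet_of convex hull S"
    and pq: "p \<in> S" "q \<in> S" "a \<bullet> p < b" "a \<bullet> q < b"
  let ?G = "{s \<in> S. a \<bullet> s = b}"
  have fin: "finite S" using ex by (simp add: exact_set_def)
  have C: "convex hull S \<inter> {x. a \<bullet> x = b} = convex hull ?G"
    by (rule convex_hull_Int_supporting_hyperplane) (use fin le in auto)
  with facet have G: "?G \<noteq> {}" "aff_dim ?G = aff_dim S - 1"
    by (auto simp: facet_of_def aff_dim_convex_hull)
  let ?H = "affine hull S \<inter> {x. a \<bullet> x = b}"
  have affH: "affine ?H" by (intro affine_Int affine_affine_hull affine_hyperplane)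
  have sub: "affine hull ?G \<subseteq> ?H"
    by (rule hull_minimal) (use affH in \<open>auto intro: hull_inc\<close>)
  have "p \<in> affine hull S" "p \<notin> ?H" using pq by (auto intro: hull_inc)
  then have "?H \<subset> affine hull S" by auto
  then have "aff_dim ?H < aff_dim (affine hull S)"
    using affH by (intro aff_dim_psubset) (simp add: hull_same)
  moreover have "aff_dim ?G \<le> aff_dim ?H"
    using sub hull_subset[of ?G affine] by (intro aff_dim_subset) auto
  ultimately have "aff_dim ?H = aff_dim (affine hull ?G)" using G by simp
  then have H: "affine hull ?G = ?H"
    by (intro affine_dim_equal affH sub) (use G in auto)
  let ?g = "(b, - a)"
  have hyp: "affine hull {s \<in> S. aff ?g s = 0} = affine hull S \<inter> {x. aff ?g x = 0}"
    using H by (simp add: eq_commute[of b])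
  have "aff ?g v \<le> aff ?g u" if "u \<in> S" "v \<in> S" "a \<bullet> u < b" for u v
    by (rule exact_set_values[OF ex _ hyp]) (use le that in auto)
  from this[of p q] this[of q p] pq show "a \<bullet> p = a \<bullet> q" by simp
qed

subsection \<open>Facets and points of two-level sets\<close>

lemma facet_of_convex_hull_halfspace:
  fixes S :: "'a::euclidean_space set"
  assumes "finite S" and C: "C facet_of convex hull S"
  obtains a b where "\<And>s. s \<in> S \<Longrightarrow> a \<bullet> s \<le> b" "C = convex hull S \<inter> {x. a \<bullet> x = b}"
proof -
  have "C exposed_face_of convex hull S"
    using assms by (simp add: exposed_face_of_polyhedron polyhedron_convex_hull facet_of_imp_face_of)
  then obtain a b where "convex hull S \<subseteq> {x. a \<bullet> x \<le> b}" "C = convex hull S \<inter> {x. a \<bullet> x = b}"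
    by (auto simp: exposed_face_of_def)
  then show thesis by (intro that[of a b]) (auto intro: hull_inc)
qed

lemma facet_of_subset_imp_eq:
  assumes "convex P" "C facet_of P" "D facet_of P" "C \<subseteq> D"
  shows "C = D"
proof (rule ccontr)
  assume "C \<noteq> D"
  moreover have "C face_of D" "convex D"
    using assms face_of_subset[of C P D] face_of_imp_subset[of D P] face_of_imp_convex[of D P]
    by (simp_all add: facet_of_def)
  ultimately have "aff_dim C < aff_dim D" by (intro face_of_aff_dim_lt)
  with assms show False by (simp add: facet_of_def)
qed

text \<open>The slack \<open>b - a \<bullet> s\<close> has a single nonzero value \<open>c\<close>
  on \<open>S\<close>, attained because a facet is not the whole hull; dividing by \<open>c\<close>
  gives f.\<close>

lemma two_level_facet_normalized:
  fixes S :: "'a::euclidean_space set"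
  assumes fin: "finite S" and two: "two_level S" and C: "C facet_of convex hull S"
  shows "\<exists>f. (\<forall>s\<in>S. aff f s \<in> {0, 1}) \<and> C = convex hull {s \<in> S. aff f s = 0}"
proof -
  obtain a b where le: "\<And>s. s \<in> S \<Longrightarrow> a \<bullet> s \<le> b" and Cab: "C = convex hull S \<inter> {x. a \<bullet> x = b}"
    using facet_of_convex_hull_halfspace[OF fin C] by blast
  have hull: "C = convex hull {s \<in> S. a \<bullet> s = b}"
    unfolding Cab by (rule convex_hull_Int_supporting_hyperplane[OF fin le])
  have "C \<noteq> convex hull S" using C by auto
  then have "{s \<in> S. a \<bullet> s = b} \<noteq> S" using hull by metis
  then obtain p where p: "p \<in> S" "a \<bullet> p < b" using le by force
  define c where "c = b - a \<bullet> p"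
  have c: "c > 0" using p by (simp add: c_def)
  have lev: "a \<bullet> s = b \<or> a \<bullet> s = b - c" if "s \<in> S" for s
  proof (cases "a \<bullet> s = b")
    case False
    then have "a \<bullet> s < b" using le[OF that] by simp
    moreover have "\<forall>s\<in>S. a \<bullet> s \<le> b" using le by blast
    ultimately have "a \<bullet> p = a \<bullet> s"
      using two C p that unfolding two_level_def Cab by blast
    then show ?thesis by (simp add: c_def)
  qed simp
  let ?f = "(b / c, - (1 / c) *\<^sub>R a)"
  have f: "aff ?f x = (b - a \<bullet> x) / c" for x by (simp add: diff_divide_distrib)
  have "aff ?f s \<in> {0, 1}" if "s \<in> S" for s
    unfolding f using lev[OF that] c by auto
  moreover have "{s \<in> S. aff ?f s = 0} = {s \<in> S. a \<bullet> s = b}"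
    unfolding f using c by auto
  then have "C = convex hull {s \<in> S. aff ?f s = 0}" using hull by (simp only:)
  ultimately show ?thesis by (intro exI[of _ ?f] conjI ballI)
qed

text \<open>
  Fix a facet \<open>F\<close> with affine basis \<open>B \<subseteq> S\<close>. The normalized equations \<open>f\<^sub>1\<close>, \<open>f\<^sub>2\<close> of two facets
  meeting \<open>B\<close> in the same points differ by a multiple of the equation of \<open>F\<close>; if they differ, then
  one of \<open>f\<^sub>1\<close>, \<open>f\<^sub>2\<close> is constantly \<open>1\<close> on \<open>S - F\<close>, so its facet is \<open>F\<close>.
\<close>
lemma two_level_card_facets:
  fixes S :: "'a::euclidean_space set"
  assumes fin: "finite S" and two: "two_level S"
  shows "real (card {C. C facet_of convex hull S}) \<le> 2 powi aff_dim S"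
proof (cases "{C. C facet_of convex hull S} = {}")
  case True
  \<comment> \<open>The exponent is -1 for empty \<open>S\<close>, but the real power is nonnegative
    all the same.\<close>
  then show ?thesis by (metis card.empty of_nat_0 zero_le_numeral zero_le_power_int)
next
  case False
  then obtain F where F: "F facet_of convex hull S" by blast
  obtain e where e: "\<And>C. C facet_of convex hull S \<Longrightarrow>
      (\<forall>s\<in>S. aff (e C) s \<in> {0, 1}) \<and> C = convex hull {s \<in> S. aff (e C) s = 0}"
    using choice[of "\<lambda>C f. C facet_of convex hull S \<longrightarrow>
        (\<forall>s\<in>S. aff f s \<in> {0, 1}) \<and> C = convex hull {s \<in> S. aff f s = 0}"]
      two_level_facet_normalized[OF fin two] by blast
  have e01: "aff (e C) s = 0 \<or> aff (e C) s = 1" if "C facet_of convex hull S" "s \<in> S" for C s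
    using e[OF that(1)] that(2) by blast
  let ?Z = "\<lambda>C. {s \<in> S. aff (e C) s = 0}"
  have sub: "C = D" if "C facet_of convex hull S" "D facet_of convex hull S" "?Z C \<subseteq> ?Z D" for C D
    by (rule facet_of_subset_imp_eq[OF convex_convex_hull that(1,2)])
      (use e[OF that(1)] e[OF that(2)] hull_mono[OF that(3), of convex] in simp)
  obtain B where B: "B \<subseteq> ?Z F" "affine hull B = affine hull ?Z F"
      "\<not> affine_dependent B" "of_nat (card B) = aff_dim (?Z F) + 1"
    using aff_dim_inner_basis_exists by blast
  have dimF: "aff_dim (?Z F) = aff_dim S - 1"
    using F e[OF F] by (simp add: facet_of_def aff_dim_convex_hull) (metis aff_dim_convex_hull)
  have cardB: "int (card B) = aff_dim S" using B(4) dimF by simp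
  have "F \<noteq> convex hull S" using F by auto
  moreover have "F = convex hull ?Z F" using e[OF F] by (rule conjunct2)
  ultimately have "?Z F \<noteq> S" by (auto simp only:)
  \<comment> \<open>A point off \<open>F\<close> completes \<open>B\<close> to an affine spanning
    set, so an affine function on \<open>S\<close> is known from its values on \<open>B\<close> and
    at \<open>v\<close>.\<close>
  then obtain v where v: "v \<in> S" "aff (e F) v = 1" using e01[OF F] by blast
  have affine0: "affine {x :: 'a. aff h x = 0}" for h
  proof -
    have "{x. aff h x = 0} = {x. snd h \<bullet> x = - fst h}" by (auto simp: add_eq_0_iff)
    then show ?thesis using affine_hyperplane by simp
  qed
  have "?Z F \<subseteq> {x. aff (e F) x = 0}" by auto
  then have "affine hull ?Z F \<subseteq> {x. aff (e F) x = 0}" using affine0 by (rule hull_minimal)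
  then have "v \<notin> affine hull B" using B(2) v by auto
  then have "aff_dim (insert v B) = aff_dim B + 1" by (simp add: aff_dim_insert)
  also have "\<dots> = aff_dim S" using B dimF by (metis aff_dim_affine_hull diff_add_cancel)
  finally have "aff_dim (affine hull (insert v B)) = aff_dim (affine hull S)" by simp
  then have span: "affine hull (insert v B) = affine hull S"
    by (intro affine_dim_equal affine_affine_hull hull_mono) (use B v in auto)
  have "C = D" if C: "C facet_of convex hull S" and D: "D facet_of convex hull S"
      and eq: "?Z C \<inter> B = ?Z D \<inter> B" for C D
  proof -
    have BS: "B \<subseteq> S" using B by auto
    have agree: "aff (e C) s = aff (e D) s" if "s \<in> B" for s
    proof -
      have "aff (e C) s = 0 \<longleftrightarrow> aff (e D) s = 0" using eq that BS by blast
      then show ?thesis using e01[OF C] e01[OF D] that BS by (metis subsetD)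
    qed
    \<comment> \<open>The difference of the two equations vanishes on \<open>B\<close>, as
      \<open>e F\<close> does, and \<open>e F\<close> is 1 at \<open>v\<close>; the multiplier must
      therefore be the difference at \<open>v\<close>, which is 0, 1 or -1.\<close>
    define k where "k = aff (e C) v - aff (e D) v"
    have k: "aff (e C) s - aff (e D) s = k * aff (e F) s" if "s \<in> S" for s
    proof -
      let ?h = "(fst (e C) - fst (e D) - k * fst (e F), snd (e C) - snd (e D) - k *\<^sub>R snd (e F))"
      have h: "aff ?h x = aff (e C) x - aff (e D) x - k * aff (e F) x" for x
        by (simp add: inner_diff_left algebra_simps)
      have "insert v B \<subseteq> {x. aff ?h x = 0}"
        unfolding h using agree B(1) v by (auto simp: k_def)
      then have "affine hull insert v B \<subseteq> {x. aff ?h x = 0}" using affine0 by (rule hull_minimal)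
      moreover have "s \<in> affine hull insert v B" unfolding span using that by (rule hull_inc)
      ultimately show ?thesis using h[of s] by auto
    qed
    have off: "aff (e C) s - aff (e D) s = k" if "s \<in> S" "aff (e F) s \<noteq> 0" for s
      using k[OF that(1)] e01[OF F that(1)] that(2) by auto
    consider "k = 0" | "k = 1" | "k = - 1"
      using e01[OF C v(1)] e01[OF D v(1)] by (auto simp: k_def)
    then show ?thesis
    proof cases
      case 1
      then have "?Z C \<subseteq> ?Z D" using k by auto
      then show ?thesis by (rule sub[OF C D])
    next
      case 2
      then have "aff (e F) s = 0" if "s \<in> S" "aff (e C) s = 0" for s
        using off[OF that(1)] e01[OF D that(1)] that(2) by force
      then have "?Z C \<subseteq> ?Z F" by auto
      then have "C = F" by (rule sub[OF C F])
      \<comment> \<open>Now \<open>C\<close> contains all of \<open>B\<close>, and \<open>D\<close>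
        meets \<open>B\<close> in the same points. So \<open>D\<close> contains \<open>B\<close>,
        hence every point of \<open>F\<close>, and is \<open>F\<close> too.\<close>
      then have "B \<subseteq> ?Z D" using B(1) eq by auto
      then have "affine hull ?Z F \<subseteq> {x. aff (e D) x = 0}"
        unfolding B(2)[symmetric] using affine0 by (intro hull_minimal) auto
      then have "?Z F \<subseteq> ?Z D" using hull_subset[of "?Z F" affine] by auto
      then show ?thesis using sub[OF F D] \<open>C = F\<close> by simp
    next
      case 3
      then have "aff (e F) s = 0" if "s \<in> S" "aff (e D) s = 0" for s
        using off[OF that(1)] e01[OF C that(1)] that(2) by force
      then have "?Z D \<subseteq> ?Z F" by auto
      then have "D = F" by (rule sub[OF D F])
      then have "B \<subseteq> ?Z C" using B(1) eq by auto
      then have "affine hull ?Z F \<subseteq> {x. aff (e C) x = 0}"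
        unfolding B(2)[symmetric] using affine0 by (intro hull_minimal) auto
      then have "?Z F \<subseteq> ?Z C" using hull_subset[of "?Z F" affine] by auto
      then show ?thesis using sub[OF F C] \<open>D = F\<close> by simp
    qed
  qed
  then have "inj_on (\<lambda>C. ?Z C \<inter> B) {C. C facet_of convex hull S}" by (intro inj_onI) blast
  moreover have finB: "finite B" using aff_independent_finite B(3) by blast
  ultimately have "card {C. C facet_of convex hull S} \<le> card (Pow B)"
    by (intro card_inj_on_le[of "\<lambda>C. ?Z C \<inter> B"]) auto
  then have "real (card {C. C facet_of convex hull S}) \<le> 2 ^ card B"
    using finB by (metis card_Pow of_nat_le_iff of_nat_numeral of_nat_power)
  then show ?thesis unfolding cardB[symmetric] by simp
qed

text \<open>A slack on \<open>S\<close> is zero or one fixed value, so the vanishing pattern on a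
  basis of the normals fixes all products \<open>a h \<bullet> s\<close>. Normals parallel to the
  affine hull have rank at most its dimension, and boundedness makes points with equal products
  coincide.\<close>

lemma two_level_card:
  fixes S :: "'a::euclidean_space set"
  assumes fin: "finite S" and two: "two_level S"
  shows "real (card S) \<le> 2 powi aff_dim S"
proof (cases "S = {}")
  case False
  let ?P = "convex hull S"
  have "polyhedron ?P" using fin by (rule polyhedron_convex_hull)
  \<comment> \<open>Minimality of \<open>H\<close> makes each of its bounding hyperplanes cut out a
    facet; without it, two-levelness would say nothing about them.\<close>
  then obtain H where H: "finite H" "?P = affine hull ?P \<inter> \<Inter>H"
      "\<forall>h\<in>H. \<exists>a b. a \<noteq> 0 \<and> h = {x. a \<bullet> x \<le> b} \<and> (\<forall>x\<in>affine hull ?P. x + a \<in> affine hull ?P)"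
      "\<forall>F'. F' \<subset> H \<longrightarrow> ?P \<subset> affine hull ?P \<inter> \<Inter>F'"
    unfolding polyhedron_Int_affine_parallel_minimal by blast
  then obtain a b where ab: "\<And>h. h \<in> H \<Longrightarrow> a h \<noteq> 0 \<and> h = {x. a h \<bullet> x \<le> b h} \<and>
      (\<forall>x\<in>affine hull S. x + a h \<in> affine hull S)"
    unfolding affine_hull_convex_hull by metis
  have facet: "(?P \<inter> {x. a h \<bullet> x = b h}) facet_of ?P" if "h \<in> H" for h
    using facet_of_polyhedron_explicit[OF H(1,2), of a b] ab H(4) that by blast
  have le: "a h \<bullet> s \<le> b h" if "h \<in> H" "s \<in> S" for h s
  proof -
    have "s \<in> h" using H(2) that hull_inc[of s S convex] by blast
    then show ?thesis using ab[OF that(1)] by blast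
  qed
  obtain N where N: "N \<subseteq> a ` H" "a ` H \<subseteq> span N" "card N = dim (a ` H)"
    using basis_exists by metis
  obtain p where p: "p \<in> S" using False by blast
  then have pS: "p \<in> affine hull S" by (rule hull_inc)
  have "a ` H \<subseteq> (\<lambda>x. x - p) ` (affine hull S)"
  proof
    fix y assume "y \<in> a ` H"
    then have "p + y \<in> affine hull S" using ab pS by auto
    then show "y \<in> (\<lambda>x. x - p) ` (affine hull S)" by (intro image_eqI[of _ _ "p + y"]) auto
  qed
  then have "dim (a ` H) \<le> dim ((\<lambda>x. x - p) ` (affine hull S))" by (rule dim_subset)
  then have cardN: "int (card N) \<le> aff_dim S"
    using aff_dim_dim_affine_diffs[OF affine_affine_hull pS] N(3) by simp
  obtain K where K: "K \<subseteq> H" "inj_on a K" "N = a ` K"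
    using N(1) by (metis subset_image_inj)
  have finK: "finite K" using K(1) H(1) finite_subset by blast
  have "s = t" if st: "s \<in> S" "t \<in> S"
      and eq: "{h \<in> K. a h \<bullet> s = b h} = {h \<in> K. a h \<bullet> t = b h}" for s t
  proof -
    have "a h \<bullet> s = a h \<bullet> t" if h: "h \<in> K" for h
    proof (cases "a h \<bullet> s = b h")
      case True
      then have "h \<in> {h \<in> K. a h \<bullet> t = b h}" unfolding eq[symmetric] using h by simp
      then show ?thesis using True by simp
    next
      case False
      then have "a h \<bullet> s < b h" "a h \<bullet> t < b h"
        using eq h le[of h] st K(1) by fastforce+
      then show ?thesis
        using two facet[of h] le[of h] h K(1) st unfolding two_level_def by blast
    qed
    then have "N \<subseteq> {x. (s - t) \<bullet> x = 0}"
      unfolding K(3) by (auto simp: inner_commute[of "s - t"] inner_diff_right)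
    then have "span N \<subseteq> {x. (s - t) \<bullet> x = 0}"
      by (rule span_minimal) (rule subspace_hyperplane)
    then have orth: "a h \<bullet> s = a h \<bullet> t" if "h \<in> H" for h
      using N(2) that by (auto simp: inner_commute[of "s - t"] inner_diff_right)
    \<comment> \<open>Each normal is constant on the line through \<open>s\<close> and
      \<open>t\<close>, so the line stays in the polytope; a bounded affine set is at most a
      point.\<close>
    have "affine hull {s, t} \<subseteq> ?P"
    proof
      fix x assume x: "x \<in> affine hull {s, t}"
      then obtain u v where uv: "x = u *\<^sub>R s + v *\<^sub>R t" "u + v = 1" by (auto simp: affine_hull_2)
      have "a h \<bullet> x \<le> b h" if "h \<in> H" for h
      proof -
        have "a h \<bullet> x = (u + v) * (a h \<bullet> t)"
          unfolding uv(1) using orth[OF that] by (simp add: inner_add_right distrib_right)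
        then show ?thesis using le[OF that st(2)] uv(2) by simp
      qed
      then have "x \<in> \<Inter>H" using ab by blast
      moreover have "x \<in> affine hull ?P"
        using x hull_mono[of "{s, t}" S affine] st by auto
      ultimately show "x \<in> ?P" using H(2) by blast
    qed
    moreover have "bounded ?P" using fin by (simp add: bounded_convex_hull finite_imp_bounded)
    ultimately have "bounded (affine hull {s, t})" using bounded_subset by blast
    then have "aff_dim (affine hull {s, t}) \<le> 0"
      using affine_bounded_eq_lowdim affine_affine_hull by blast
    then show ?thesis by (simp split: if_splits)
  qed
  then have "inj_on (\<lambda>s. {h \<in> K. a h \<bullet> s = b h}) S" by (intro inj_onI) blast
  then have "card S \<le> card (Pow K)"
    by (rule card_inj_on_le) (use finK in auto)
  then have "real (card S) \<le> 2 ^ card N"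
    using finK K by (metis card_Pow card_image of_nat_le_iff of_nat_numeral of_nat_power)
  also have "\<dots> = 2 powi int (card N)" by simp
  also have "\<dots> \<le> 2 powi aff_dim S" using cardN by (intro power_int_increasing) auto
  finally show ?thesis .
qed simp

subsection \<open>The cube and the cross-polytope\<close>

text \<open>
  It suffices to cut out the convex hull by affine equations (\<open>Z\<close>) and by inequalities \<open>0 \<le> f\<close>
  whose \<open>f\<close> takes only the values \<open>0\<close> and \<open>1\<close> on \<open>T\<close>: such an \<open>f\<close> equals \<open>f\<^sup>2\<close> on \<open>T\<close>.
\<close>
lemma exact_setI:
  fixes T :: "(real ^ 'n::finite) set"
  assumes "finite T"
    and Z: "\<And>f s. f \<in> Z \<Longrightarrow> s \<in> T \<Longrightarrow> aff f s = 0"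
    and L: "\<And>f s. f \<in> L \<Longrightarrow> s \<in> T \<Longrightarrow> aff f s \<in> {0, 1}"
    and cut: "\<And>x. (\<And>f. f \<in> Z \<Longrightarrow> aff f x = 0) \<Longrightarrow> (\<And>f. f \<in> L \<Longrightarrow> 0 \<le> aff f x)
      \<Longrightarrow> x \<in> convex hull T"
  shows "exact_set T"
proof -
  have "x \<in> convex hull T" if x: "x \<in> TH1 (vanishing_ideal T)" for x
  proof (rule cut)
    have sos: "0 \<le> aff f x" if "\<And>s. s \<in> T \<Longrightarrow> aff f s = (\<Sum>h\<leftarrow>hs. (aff h s)\<^sup>2)" for f hs
      using x that unfolding in_TH1_vanishing_ideal_iff by blast
    \<comment> \<open>On \<open>T\<close> both f and its negative equal the empty sum of
      squares.\<close>
    show "aff f x = 0" if "f \<in> Z" for f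
    proof -
      have "0 \<le> aff f x" by (rule sos[where hs = "[]"]) (use Z[OF that] in simp)
      moreover have "0 \<le> aff (- f) x"
        by (rule sos[where hs = "[]"]) (use Z[OF that] in \<open>auto simp: add_eq_0_iff\<close>)
      ultimately show ?thesis by simp
    qed
    show "0 \<le> aff f x" if "f \<in> L" for f
    proof (rule sos[where hs = "[f]"])
      fix s assume "s \<in> T"
      from L[OF that this] have "aff f s = 0 \<or> aff f s = 1" by blast
      then show "aff f s = (\<Sum>h\<leftarrow>[f]. (aff h s)\<^sup>2)" by (elim disjE) simp_all
    qed
  qed
  then show ?thesis
    using assms(1) convex_hull_subset_TH1[of T] by (auto simp: exact_set_def)
qed

lemma aff_dim_convex_hull_coordinate:
  fixes T :: "(real ^ 'n::finite) set"
  assumes "0 \<in> convex hull T" "\<And>i. i \<in> D \<Longrightarrow> axis i 1 \<in> T"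
    and "\<And>x i. x \<in> T \<Longrightarrow> i \<notin> D \<Longrightarrow> x $ i = 0"
  shows "aff_dim (convex hull T) = int (card D)"
proof -
  let ?E = "(\<lambda>i. axis i (1::real)) ` D :: (real ^ 'n) set"
  have "0 \<in> affine hull T" using assms(1) convex_hull_subset_affine_hull by blast
  then have "aff_dim (convex hull T) = int (dim T)" by (simp add: aff_dim_convex_hull aff_dim_zero)
  also have "dim T = card ?E"
  proof (rule dim_unique)
    show "?E \<subseteq> T" using assms(2) by auto
    show "T \<subseteq> span ?E"
    proof
      fix x assume x: "x \<in> T"
      have "x = (\<Sum>i\<in>UNIV. (x $ i) *\<^sub>R axis i 1)"
        using basis_expansion[of x] by (simp add: scalar_mult_eq_scaleR)
      also have "\<dots> = (\<Sum>i\<in>D. (x $ i) *\<^sub>R axis i 1)"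
        by (rule sum.mono_neutral_right) (use assms(3)[OF x] in auto)
      also have "\<dots> \<in> span ?E" by (intro span_sum span_scale span_base) auto
      finally show "x \<in> span ?E" .
    qed
    show "independent ?E" by (rule independent_substdbasis) (auto simp: Basis_vec_def)
  qed simp
  also have "card ?E = card D" by (rule card_image) (auto simp: inj_on_def axis_eq_axis)
  finally show ?thesis .
qed

section \<open>The cube: many vertices\<close>

definition cube_vertices :: "'n::finite set \<Rightarrow> (real ^ 'n) set" where
  "cube_vertices D = {x. (\<forall>i\<in>D. x $ i \<in> {0, 1}) \<and> (\<forall>i. i \<notin> D \<longrightarrow> x $ i = 0)}"

lemma cube_vertices_eq_image: "cube_vertices D = (\<lambda>A. \<chi> i. if i \<in> A then 1 else 0) ` Pow D"
proof (rule set_eqI, rule iffI)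
  fix x assume "x \<in> cube_vertices D"
  then have "x = (\<chi> i. if i \<in> {i \<in> D. x $ i = 1} then 1 else 0)"
    by (auto simp: cube_vertices_def vec_eq_iff)
  then show "x \<in> (\<lambda>A. \<chi> i. if i \<in> A then 1 else 0) ` Pow D" by (rule image_eqI) auto
qed (auto simp: cube_vertices_def)

lemma card_cube_vertices: "card (cube_vertices D) = 2 ^ card D"
proof -
  have "inj_on (\<lambda>A. (\<chi> i. if i \<in> A then 1 else 0) :: real ^ 'a) (Pow D)"
  proof (rule inj_onI)
    fix A B :: "'a set"
    assume eq: "(\<chi> i. if i \<in> A then 1 else 0) = ((\<chi> i. if i \<in> B then 1 else 0) :: real ^ 'a)"
    have "i \<in> A \<longleftrightarrow> i \<in> B" for i
      using arg_cong[OF eq, of "\<lambda>x. x $ i"] by (simp split: if_splits)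
    then show "A = B" by blast
  qed
  then show ?thesis by (simp add: cube_vertices_eq_image card_image card_Pow)
qed

lemma convex_hull_cube_vertices:
  "convex hull cube_vertices D =
     {x. (\<forall>i\<in>D. 0 \<le> x $ i \<and> x $ i \<le> 1) \<and> (\<forall>i. i \<notin> D \<longrightarrow> x $ i = 0)}" (is "_ = ?C D")
proof
  have "convex (?C D)"
    unfolding convex_def
    by (auto intro!: add_nonneg_nonneg convex_bound_le)
  then show "convex hull cube_vertices D \<subseteq> ?C D"
    by (intro hull_minimal) (fastforce simp: cube_vertices_def)+
  \<comment> \<open>Induction on the set \<open>E\<close> of coordinates still allowed to be
    fractional: each step splits \<open>x\<close> along one of them into points where it is 0 and
    1.\<close>
  have hull: "x \<in> convex hull cube_vertices D"
    if "finite E" "E \<subseteq> D" "x \<in> ?C D" "\<forall>i\<in>D - E. x $ i \<in> {0, 1}" for E x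
    using that
  proof (induction E arbitrary: x rule: finite_induct)
    case empty
    then show ?case by (auto simp: cube_vertices_def intro: hull_inc)
  next
    case (insert j E)
    define y where "y c = (\<chi> i. if i = j then c else x $ i)" for c :: real
    have y: "y c \<in> convex hull cube_vertices D" if "c \<in> {0, 1}" for c
      by (rule insert.IH) (use insert.prems that in \<open>auto simp: y_def\<close>)
    have "x = (1 - x $ j) *\<^sub>R y 0 + (x $ j) *\<^sub>R y 1"
      by (auto simp: y_def vec_eq_iff algebra_simps)
    also have "\<dots> \<in> convex hull cube_vertices D"
      by (rule convexD[OF convex_convex_hull y y]) (use insert.prems in auto)
    finally show ?case .
  qed
  show "?C D \<subseteq> convex hull cube_vertices D"
    by (intro subsetI hull[of D]) auto
qed

lemma exact_cube_vertices: "exact_set (cube_vertices (D :: 'n::finite set))"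
proof -
  let ?Z = "(\<lambda>i. (0, axis i 1)) ` (- D) :: (real \<times> (real ^ 'n)) set"
  let ?L = "(\<lambda>i. (0, axis i 1)) ` D \<union> (\<lambda>i. (1, - axis i 1)) ` D
    :: (real \<times> (real ^ 'n)) set"
  show ?thesis
  proof (rule exact_setI[where Z = ?Z and L = ?L])
    show "finite (cube_vertices D)" by (simp add: cube_vertices_eq_image)
    show "aff f s = 0" if "f \<in> ?Z" "s \<in> cube_vertices D" for f s
      using that by (auto simp: cube_vertices_def inner_axis')
    show "aff f s \<in> {0, 1}" if "f \<in> ?L" "s \<in> cube_vertices D" for f s
      using that by (auto simp: cube_vertices_def inner_axis')
    fix x
    assume "\<And>f. f \<in> ?Z \<Longrightarrow> aff f x = 0" and L: "\<And>f. f \<in> ?L \<Longrightarrow> 0 \<le> aff f x"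
    then have "x $ i = 0" if "i \<notin> D" for i
      using that by (fastforce simp: inner_axis')
    moreover have "0 \<le> x $ i" if "i \<in> D" for i
      using L[of "(0, axis i 1)"] that by (simp add: inner_axis')
    moreover have "x $ i \<le> 1" if "i \<in> D" for i
      using L[of "(1, - axis i 1)"] that by (simp add: inner_axis')
    ultimately show "x \<in> convex hull cube_vertices D" by (auto simp: convex_hull_cube_vertices)
  qed
qed

lemma aff_dim_cube: "aff_dim (convex hull cube_vertices D) = int (card D)"
proof (rule aff_dim_convex_hull_coordinate)
  show "0 \<in> convex hull cube_vertices D" by (simp add: convex_hull_cube_vertices)
qed (auto simp: cube_vertices_def axis_def)

lemma vertices_cube: "vertices (convex hull cube_vertices D) = cube_vertices D"
proof
  show "vertices (convex hull cube_vertices D) \<subseteq> cube_vertices D"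
    by (auto simp: vertices_def dest: extreme_point_of_convex_hull)
  show "cube_vertices D \<subseteq> vertices (convex hull cube_vertices D)"
  proof
    fix v assume v: "v \<in> cube_vertices D"
    have "v \<notin> open_segment a b"
      if a: "a \<in> convex hull cube_vertices D" and b: "b \<in> convex hull cube_vertices D" for a b
    proof
      assume "v \<in> open_segment a b"
      then obtain u where u: "a \<noteq> b" "0 < u" "u < 1" "v = (1 - u) *\<^sub>R a + u *\<^sub>R b"
        by (auto simp: in_segment)
      \<comment> \<open>An endpoint of the unit interval is not a proper average of two distinct
        points of the interval.\<close>
      have "a $ i = b $ i" for i
      proof (cases "i \<in> D")
        case True
        then have ab: "0 \<le> a $ i" "a $ i \<le> 1" "0 \<le> b $ i" "b $ i \<le> 1"
          using a b by (auto simp: convex_hull_cube_vertices)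
        have "v $ i = 0 \<or> v $ i = 1" using v True by (auto simp: cube_vertices_def)
        then show ?thesis
        proof
          assume "v $ i = 0"
          then have "(1 - u) * a $ i + u * b $ i = 0" using u(4) by simp
          then have "(1 - u) * a $ i = 0 \<and> u * b $ i = 0"
            using u ab by (subst (asm) add_nonneg_eq_0_iff) auto
          then show ?thesis using u by simp
        next
          assume "v $ i = 1"
          then have "(1 - u) * (1 - a $ i) + u * (1 - b $ i) = 0"
            using u(4) by (simp add: algebra_simps)
          then have "(1 - u) * (1 - a $ i) = 0 \<and> u * (1 - b $ i) = 0"
            using u ab by (subst (asm) add_nonneg_eq_0_iff) auto
          then show ?thesis using u by simp
        qed
      next
        case False
        then show ?thesis using a b by (auto simp: convex_hull_cube_vertices)
      qed
      then show False using u(1) by (simp add: vec_eq_iff)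
    qed
    then show "v \<in> vertices (convex hull cube_vertices D)"
      using v by (auto simp: vertices_def extreme_point_of_def intro: hull_inc)
  qed
qed

section \<open>The cross-polytope: many facets\<close>

definition cross_vertices :: "'n::finite set \<Rightarrow> (real ^ 'n) set" where
  "cross_vertices D = (\<lambda>i. axis i 1) ` D \<union> (\<lambda>i. - axis i 1) ` D"

text \<open>For \<open>A \<subseteq> D\<close> these are the facet normals of the cross-polytope,
  \<open>A\<close> being the set of positive signs.\<close>

definition sign_vector :: "'n::finite set \<Rightarrow> 'n set \<Rightarrow> real ^ 'n" where
  "sign_vector D A = (\<chi> i. if i \<in> A then 1 else if i \<in> D then - 1 else 0)"

lemma sign_vector_cross_vertices:
  assumes "s \<in> cross_vertices D"
  shows "sign_vector D A \<bullet> s = 1 \<or> sign_vector D A \<bullet> s = - 1"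
  using assms by (auto simp: cross_vertices_def sign_vector_def inner_axis split: if_splits)

lemma zero_in_convex_hull_cross_vertices:
  assumes "D \<noteq> {}"
  shows "0 \<in> convex hull cross_vertices D"
proof -
  obtain i where "i \<in> D" using assms by blast
  then have "(1 / 2) *\<^sub>R axis i 1 + (1 / 2) *\<^sub>R (- axis i 1) \<in> convex hull cross_vertices D"
    by (intro convexD[OF convex_convex_hull] hull_inc) (auto simp: cross_vertices_def)
  then show ?thesis by simp
qed

text \<open>The missing weight goes to the point 0, carried by the extra index
  \<open>None\<close>.\<close>

lemma convex_sum_le_1:
  fixes C :: "'a::real_vector set"
  assumes "convex C" "0 \<in> C" "finite I" "\<And>i. i \<in> I \<Longrightarrow> 0 \<le> u i" "sum u I \<le> 1"
    and "\<And>i. i \<in> I \<Longrightarrow> y i \<in> C"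
  shows "(\<Sum>i\<in>I. u i *\<^sub>R y i) \<in> C"
proof -
  let ?J = "insert None (Some ` I)"
  let ?u = "\<lambda>j. case j of None \<Rightarrow> 1 - sum u I | Some i \<Rightarrow> u i"
  let ?y = "\<lambda>j. case j of None \<Rightarrow> 0 | Some i \<Rightarrow> y i"
  have "(\<Sum>j\<in>?J. ?u j *\<^sub>R ?y j) \<in> C"
    by (rule convex_sum) (use assms in \<open>auto simp: sum.reindex\<close>)
  then show ?thesis using assms(3) by (simp add: sum.reindex)
qed

lemma in_convex_hull_cross_vertices:
  assumes "D \<noteq> {}" and supp: "\<And>i. i \<notin> D \<Longrightarrow> x $ i = 0" and le: "(\<Sum>i\<in>D. \<bar>x $ i\<bar>) \<le> 1"
  shows "x \<in> convex hull cross_vertices D"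
proof -
  have "x = (\<Sum>i\<in>UNIV. (x $ i) *\<^sub>R axis i 1)"
    using basis_expansion[of x] by (simp add: scalar_mult_eq_scaleR)
  also have "\<dots> = (\<Sum>i\<in>D. (x $ i) *\<^sub>R axis i 1)"
    by (rule sum.mono_neutral_right) (use supp in auto)
  also have "\<dots> = (\<Sum>i\<in>D. \<bar>x $ i\<bar> *\<^sub>R (if 0 \<le> x $ i then axis i 1 else - axis i 1))"
    by (rule sum.cong) auto
  also have "\<dots> \<in> convex hull cross_vertices D"
    by (rule convex_sum_le_1)
      (use le zero_in_convex_hull_cross_vertices[OF assms(1)] in \<open>auto simp: cross_vertices_def intro!: hull_inc\<close>)
  finally show ?thesis .
qed

lemma exact_cross_vertices:
  assumes D: "D \<noteq> ({} :: 'n::finite set)"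
  shows "exact_set (cross_vertices D)"
proof -
  let ?Z = "(\<lambda>i. (0, axis i 1)) ` (- D) :: (real \<times> (real ^ 'n)) set"
  \<comment> \<open>Shifting and halving turns the values -1 and 1 of a sign vector into 0 and
    1.\<close>
  let ?L = "(\<lambda>A. (1 / 2, (1 / 2) *\<^sub>R sign_vector D A)) ` Pow D"
  show ?thesis
  proof (rule exact_setI[where Z = ?Z and L = ?L])
    show "finite (cross_vertices D)" by (simp add: cross_vertices_def)
    show "aff f s = 0" if "f \<in> ?Z" "s \<in> cross_vertices D" for f s
      using that by (auto simp: cross_vertices_def inner_axis_axis)
    show "aff f s \<in> {0, 1}" if "f \<in> ?L" "s \<in> cross_vertices D" for f s
    proof -
      obtain A where "f = (1 / 2, (1 / 2) *\<^sub>R sign_vector D A)" using \<open>f \<in> ?L\<close> by blast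
      then show ?thesis
        using sign_vector_cross_vertices[OF \<open>s \<in> cross_vertices D\<close>, of A]
        by (elim disjE) simp_all
    qed
    fix x
    assume Z: "\<And>f. f \<in> ?Z \<Longrightarrow> aff f x = 0" and L: "\<And>f. f \<in> ?L \<Longrightarrow> 0 \<le> aff f x"
    \<comment> \<open>The sign pattern opposite to that of \<open>x\<close>: its product with
      \<open>x\<close> is minus the l1-norm, so this one inequality already bounds the norm.\<close>
    let ?A = "{i \<in> D. x $ i < 0}"
    have supp: "x $ i = 0" if "i \<notin> D" for i
      using Z[of "(0, axis i 1)"] that by (simp add: inner_axis')
    have "sign_vector D ?A \<bullet> x = (\<Sum>i\<in>UNIV. - \<bar>x $ i\<bar>)"
      unfolding inner_vec_def by (rule sum.cong) (auto simp: sign_vector_def supp)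
    also have "\<dots> = - (\<Sum>i\<in>UNIV. \<bar>x $ i\<bar>)" by (rule sum_negf)
    also have "(\<Sum>i\<in>UNIV. \<bar>x $ i\<bar>) = (\<Sum>i\<in>D. \<bar>x $ i\<bar>)"
      by (rule sum.mono_neutral_right) (auto simp: supp)
    finally have "aff (1 / 2, (1 / 2) *\<^sub>R sign_vector D ?A) x = 1 / 2 - (\<Sum>i\<in>D. \<bar>x $ i\<bar>) / 2"
      by simp
    moreover have "0 \<le> aff (1 / 2, (1 / 2) *\<^sub>R sign_vector D ?A) x" by (rule L) auto
    ultimately have "(\<Sum>i\<in>D. \<bar>x $ i\<bar>) \<le> 1" by simp
    then show "x \<in> convex hull cross_vertices D"
      using D supp by (intro in_convex_hull_cross_vertices)
  qed
qed

lemma aff_dim_cross: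
  assumes "D \<noteq> {}"
  shows "aff_dim (convex hull cross_vertices D) = int (card D)"
proof (rule aff_dim_convex_hull_coordinate)
  show "0 \<in> convex hull cross_vertices D" using assms by (rule zero_in_convex_hull_cross_vertices)
qed (auto simp: cross_vertices_def axis_def)

text \<open>The face is proper, so its dimension drops. It drops by only 1, because adjoining the
  origin, which is off the hyperplane, yields a set spanning all coordinates in
  \<open>D\<close>.\<close>

lemma cross_facet:
  fixes D :: "'n::finite set"
  assumes D: "D \<noteq> {}" and "A \<subseteq> D"
  shows "(convex hull cross_vertices D \<inter> {x. sign_vector D A \<bullet> x = 1})
    facet_of convex hull cross_vertices D" (is "?F facet_of ?P")
proof -
  define e :: "'n \<Rightarrow> real ^ 'n" where "e i = (if i \<in> A then axis i 1 else - axis i 1)" for i :: 'n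
  let ?a = "sign_vector D A"
  have "?P \<subseteq> {x. ?a \<bullet> x \<le> 1}"
    by (rule hull_minimal)
      (use sign_vector_cross_vertices[of _ D A] in \<open>force simp: convex_halfspace_le\<close>)+
  then have face: "?F face_of ?P"
    by (intro face_of_Int_supporting_hyperplane_le) auto
  have e: "e ` D \<subseteq> ?F"
    by (auto simp: e_def cross_vertices_def sign_vector_def inner_axis intro!: hull_inc)
  then have ne: "?F \<noteq> {}" using D by blast
  have "0 \<in> ?P" using zero_in_convex_hull_cross_vertices[OF D] .
  moreover have "0 \<notin> ?F" by simp
  ultimately have "?F \<noteq> ?P" by blast
  then have lt: "aff_dim ?F < aff_dim ?P"
    by (intro face_of_aff_dim_lt face) auto
  have "0 \<notin> affine hull ?F"
    using hull_minimal[of ?F "{x. ?a \<bullet> x = 1}" affine] affine_hyperplane[of ?a 1] by auto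
  then have "aff_dim (insert 0 ?F) = aff_dim ?F + 1" by (simp add: aff_dim_insert)
  moreover have "int (card D) \<le> aff_dim (insert 0 ?F)"
  proof -
    have "axis i 1 \<in> span (insert 0 ?F)" if "i \<in> D" for i
    proof -
      have "e i \<in> span (insert 0 ?F)" using e that by (auto intro: span_base)
      then have "e i \<in> span (insert 0 ?F)" "- e i \<in> span (insert 0 ?F)" by (auto intro: span_neg)
      then show ?thesis by (auto simp: e_def split: if_splits)
    qed
    then have "span ((\<lambda>i. axis i 1) ` D) \<subseteq> span (insert 0 ?F)"
      by (intro span_minimal) auto
    then have "dim ((\<lambda>i. axis i (1::real)) ` D :: (real ^ 'n) set) \<le> dim (insert 0 ?F)"
      by (metis dim_span dim_subset)
    moreover have "dim ((\<lambda>i. axis i (1::real)) ` D :: (real ^ 'n) set) = card D"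
      by (subst dim_eq_card_independent)
        (auto simp: card_image inj_on_def axis_eq_axis Basis_vec_def intro!: independent_substdbasis)
    ultimately show ?thesis by (simp add: aff_dim_zero hull_inc)
  qed
  ultimately have "aff_dim ?F = aff_dim ?P - 1"
    using lt aff_dim_cross[OF D] by linarith
  then show ?thesis using face ne by (simp add: facet_of_def)
qed

text \<open>Distinct sign patterns give distinct facets, as \<open>A\<close> can be read off from
  the unit vectors in the facet. The matching upper bound comes from exactness, so the facets are
  never classified.\<close>

lemma cross_facets_ge:
  fixes D :: "'n::finite set"
  assumes D: "D \<noteq> {}"
  shows "2 ^ card D \<le> card (facets (convex hull cross_vertices D))"
proof -
  let ?P = "convex hull cross_vertices D"
  let ?F = "\<lambda>A. ?P \<inter> {x. sign_vector D A \<bullet> x = 1}"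
  have "inj_on ?F (Pow D)"
  proof (rule inj_onI)
    fix A B assume AB: "A \<in> Pow D" "B \<in> Pow D" and eq: "?F A = ?F B"
    have "i \<in> A \<longleftrightarrow> i \<in> B" for i
    proof (cases "i \<in> D")
      case True
      have iff: "axis i 1 \<in> ?F C \<longleftrightarrow> i \<in> C" for C
        using True by (auto simp: sign_vector_def inner_axis cross_vertices_def intro!: hull_inc)
      show ?thesis using iff[of A] iff[of B] unfolding eq by blast
    qed (use AB in auto)
    then show "A = B" by blast
  qed
  then have "card (Pow D) \<le> card (facets ?P)"
  proof (rule card_inj_on_le)
    show "?F ` Pow D \<subseteq> facets ?P" using cross_facet[OF D] by (auto simp: facets_def)
    show "finite (facets ?P)"
      unfolding facets_def
      by (intro finite_polytope_facets polytope_convex_hull) (simp add: cross_vertices_def)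
  qed
  then show ?thesis by (simp add: card_Pow)
qed

section \<open>Bounds and sharpness\<close>

lemma exact_set_bounds:
  fixes S :: "(real ^ 'n::finite) set"
  assumes ex: "exact_set S"
  shows "finite (facets (convex hull S))"
    and "real (card (facets (convex hull S))) \<le> 2 powi aff_dim (convex hull S)"
    and "finite (vertices (convex hull S))"
    and "real (card (vertices (convex hull S))) \<le> 2 powi aff_dim (convex hull S)"
proof -
  have fin: "finite S" using ex by (simp add: exact_set_def)
  show "finite (facets (convex hull S))"
    unfolding facets_def using fin by (intro finite_polytope_facets polytope_convex_hull)
  show "real (card (facets (convex hull S))) \<le> 2 powi aff_dim (convex hull S)"
    using two_level_card_facets[OF fin exact_set_two_level[OF ex]]
    by (simp add: facets_def aff_dim_convex_hull)
  have sub: "vertices (convex hull S) \<subseteq> S"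
    by (auto simp: vertices_def dest: extreme_point_of_convex_hull)
  then show "finite (vertices (convex hull S))" using fin finite_subset by blast
  \<comment> \<open>Every vertex belongs to \<open>S\<close>, whose full cardinality is already
    bounded.\<close>
  have "real (card (vertices (convex hull S))) \<le> real (card S)"
    using card_mono[OF fin sub] by simp
  also have "\<dots> \<le> 2 powi aff_dim (convex hull S)"
    using two_level_card[OF fin exact_set_two_level[OF ex]] by (simp add: aff_dim_convex_hull)
  finally show "real (card (vertices (convex hull S))) \<le> 2 powi aff_dim (convex hull S)" .
qed

theorem theorem4p7:
  shows "(\<forall>S :: (real ^ 'n::finite) set. exact_set S \<longrightarrow>
            (let P = convex hull S; d = aff_dim P in
               finite (facets P) \<and> real (card (facets P)) \<le> 2 powi d \<and>
               finite (vertices P) \<and> real (card (vertices P)) \<le> 2 powi d))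
       \<and> (\<forall>d::nat. 1 \<le> d \<and> d \<le> CARD('m::finite) \<longrightarrow>
            (\<exists>T :: (real ^ 'm) set. exact_set T \<and> aff_dim (convex hull T) = int d \<and>
               card (facets (convex hull T)) = 2 ^ d) \<and>
            (\<exists>T :: (real ^ 'm) set. exact_set T \<and> aff_dim (convex hull T) = int d \<and>
               card (vertices (convex hull T)) = 2 ^ d))"
proof (intro conjI allI impI)
  fix S :: "(real ^ 'n) set"
  assume "exact_set S"
  then show "let P = convex hull S; d = aff_dim P in
      finite (facets P) \<and> real (card (facets P)) \<le> 2 powi d \<and>
      finite (vertices P) \<and> real (card (vertices P)) \<le> 2 powi d"
    by (simp add: Let_def exact_set_bounds)
next
  fix d :: nat
  assume "1 \<le> d \<and> d \<le> CARD('m)"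
  then obtain D :: "'m set" where "card D = d" "1 \<le> d"
    using obtain_subset_with_card_n[of d "UNIV :: 'm set"] by blast
  then have D: "card D = d" "D \<noteq> {}" by auto
  let ?X = "cross_vertices D"
  have "real (card (facets (convex hull ?X))) \<le> 2 ^ d"
    using exact_set_bounds(2)[OF exact_cross_vertices[OF D(2)]] aff_dim_cross[OF D(2)] D(1) by simp
  then have "card (facets (convex hull ?X)) \<le> 2 ^ d"
    by simp
  then show "\<exists>T :: (real ^ 'm) set. exact_set T \<and> aff_dim (convex hull T) = int d \<and>
      card (facets (convex hull T)) = 2 ^ d"
    using exact_cross_vertices[OF D(2)] aff_dim_cross[OF D(2)] cross_facets_ge[OF D(2)] D(1)
    by (intro exI[of _ ?X]) simp
  show "\<exists>T :: (real ^ 'm) set. exact_set T \<and> aff_dim (convex hull T) = int d \<and>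
      card (vertices (convex hull T)) = 2 ^ d"
    using exact_cube_vertices[of D] aff_dim_cube[of D] card_cube_vertices[of D] D(1)
    by (intro exI[of _ "cube_vertices D"]) (simp add: vertices_cube)
qed

end
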